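(* For all integers $m\ge 0$, $k\ge 1$ and $n\ge 1$, one has $S_m^{(k)}(n)=\hat S_m^{(k)}(n)$, that is, \[ \sum_{q=0}^{k(n-1)}\binom{k}{q}_{n}(k+q)^m=\frac{1}{\binom{m+k}{k}}\sum_{q=0}^{m}(-1)^q\binom{m+k}{q}B_q^{(k)}\,S(m+k-q,k)\,n^{m+k-q}. \]
   Context: For integers $k,n\ge 1$, the generalized binomial coefficients $\binom{k}{q}_n$ are defined by $\left(\sum_{i=0}^{n-1}t^i\right)^k=\sum_{q=0}^{k(n-1)}\binom{k}{q}_n t^q$. The sums of powers of integers of higher order are $S_m^{(k)}(n):=\sum_{q=0}^{k(n-1)}\binom{k}{q}_n(k+q)^m$; equivalently, $\left(\sum_{q=1}^{n}e^{qt}\right)^k=\sum_{m\ge 0}S_m^{(k)}(n)\frac{t^m}{m!}$. The higher order Bernoulli numbers $B_q^{(k)}$ are defined by $\frac{t^k}{(e^t-1)^k}=\sum_{q\ge 0}B_q^{(k)}\frac{t^q}{q!}$. $S(a,b)$ (with two integer arguments) denotes the Stirling numbers of the second kind, and $\binom{a}{b}$ without outer subscript is the ordinary binomial coefficient. The polynomials $\hat S_m^{(k)}(n)$ in $n$ are defined by $\hat S_m^{(k)}(n)=\frac{1}{\binom{m+k}{k}}\sum_{q=0}^{m}(-1)^q\binom{m+k}{q}B_q^{(k)}S(m+k-q,k)n^{m+k-q}$. *)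

theory Defs
  imports
    "HOL-Computational_Algebra.Computational_Algebra"
    "HOL-Combinatorics.Stirling"
begin

text \<open>
  The generalized binomial coefficient, usually written as a binomial symbol with
  upper entry \<open>k\<close>, lower entry \<open>q\<close> and subscript \<open>n\<close>:
  the coefficient of \<open>t ^ q\<close> in \<open>(1 + t + \<dots> + t ^ (n - 1)) ^ k\<close>.
\<close>
definition gen_binomial :: "nat \<Rightarrow> nat \<Rightarrow> nat \<Rightarrow> nat" where
  "gen_binomial k q n = coeff ((\<Sum>i<n. monom 1 i) ^ k) q"

definition power_sum :: "nat \<Rightarrow> nat \<Rightarrow> nat \<Rightarrow> nat" where
  "power_sum m k n = (\<Sum>q = 0..k * (n - 1). gen_binomial k q n * (k + q) ^ m)"

text \<open>
  The denominator below has subdegree \<open>k\<close>, so it is not a unit; division of formal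
  power series cancels the common factor \<open>fps_X ^ k\<close>, as
  \<open>bernoulli_higher_fps\<close> confirms.
\<close>
definition bernoulli_higher :: "nat \<Rightarrow> nat \<Rightarrow> rat" where
  "bernoulli_higher k q = fact q * fps_nth (fps_X ^ k / (fps_exp 1 - 1) ^ k) q"

lemma bernoulli_higher_fps:
  "Abs_fps (\<lambda>q. bernoulli_higher k q / fact q) * (fps_exp 1 - 1) ^ k = fps_X ^ k"
proof -
  have "Abs_fps (\<lambda>q. bernoulli_higher k q / fact q) = fps_X ^ k / (fps_exp (1::rat) - 1) ^ k"
    by (simp add: fps_eq_iff bernoulli_higher_def)
  moreover have "subdegree (fps_exp (1::rat) - 1) = 1"
    by (rule subdegreeI) auto
  then have "(fps_exp (1::rat) - 1) ^ k dvd fps_X ^ k"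
    by (intro dvd_power_same) (auto simp: fps_dvd_iff)
  ultimately show ?thesis
    by simp
qed

definition power_sum_poly :: "nat \<Rightarrow> nat \<Rightarrow> rat poly" where
  "power_sum_poly m k =
     smult (1 / of_nat ((m + k) choose k))
       (\<Sum>q = 0..m. monom ((-1) ^ q * of_nat ((m + k) choose q) * bernoulli_higher k q *
                           of_nat (Stirling (m + k - q) k)) (m + k - q))"

end

theory Submission
  imports Defs
begin

text \<open>
  The identity compares the coefficients of \<open>t ^ (m + k)\<close> in one equation between formal
  power series. Let \<open>E n\<close> be the geometric sum \<open>e\<^sup>t + \<dots> + e ^ (n t)\<close>. Since the generalized
  binomial coefficients are the coefficients of a power of \<open>1 + t + \<dots> + t ^ (n - 1)\<close>,
  the power sums have the exponential generating function \<open>(E n) ^ k\<close>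
  (\<open>fps_nth_exp_sum_power\<close>).

  Summing the geometric progression gives \<open>(1 - e ^ (-t)) * E n = e ^ (n t) - 1\<close>, and the
  generating function \<open>B\<close> of the higher order Bernoulli numbers, evaluated at \<open>-t\<close>, satisfies
  \<open>B (-t) * (1 - e ^ (-t)) ^ k = t ^ k\<close>. Multiplying the two,
  \<open>t ^ k * (E n) ^ k = B (-t) * (e ^ (n t) - 1) ^ k\<close> (\<open>bernoulli_exp_sum_power\<close>).
  The last factor is the generating function of the Stirling numbers of the second kind,
  scaled by \<open>k!\<close> and with \<open>t\<close> replaced by \<open>n t\<close> (\<open>fps_nth_exp_minus_one_power\<close>).
  In the resulting convolution the terms with \<open>q > m\<close> vanish because \<open>S(m + k - q, k)\<close> does.
\<close>

text \<open>
  Differentiation turns \<open>(e\<^sup>t - 1) ^ k\<close> into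
  \<open>k * ((e\<^sup>t - 1) ^ k + (e\<^sup>t - 1) ^ (k - 1))\<close>; on coefficients this is the
  recurrence of the Stirling numbers.
\<close>
lemma fps_nth_exp_minus_one_power:
  "fps_nth ((fps_exp (1::'a::field_char_0) - 1) ^ k) j = fact k * of_nat (Stirling j k) / fact j"
proof (induction j arbitrary: k)
  case 0
  show ?case by (cases k) auto
next
  case (Suc j)
  show ?case
  proof (cases k)
    case 0
    then show ?thesis by simp
  next
    case (Suc l)
    let ?Y = "fps_exp (1::'a) - 1"
    have "fps_deriv (?Y ^ Suc l) = of_nat (Suc l) * (?Y ^ Suc l + ?Y ^ l)"
    proof -
      have "fps_deriv ?Y = ?Y + 1"
        by simp
      then have "fps_deriv (?Y ^ Suc l) = of_nat (Suc l) * (?Y + 1) * ?Y ^ l"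
        by (simp only: fps_deriv_power' diff_Suc_1)
      then show ?thesis
        by (simp only: mult.assoc distrib_right mult_1 power_Suc)
    qed
    then have deriv: "fps_deriv (?Y ^ Suc l) = fps_const (of_nat (Suc l)) * (?Y ^ Suc l + ?Y ^ l)"
      by (simp only: fps_of_nat)
    have "of_nat (Suc j) * fps_nth (?Y ^ Suc l) (Suc j) = fps_nth (fps_deriv (?Y ^ Suc l)) j"
      by (simp only: fps_deriv_nth Suc_eq_plus1)
    also have "\<dots> = of_nat (Suc l) * (fps_nth (?Y ^ Suc l) j + fps_nth (?Y ^ l) j)"
      by (simp only: deriv fps_mult_left_const_nth fps_add_nth)
    also have "\<dots> = fact (Suc l) * of_nat (Stirling (Suc j) (Suc l)) / fact j"
      unfolding Suc.IH by (simp add: field_simps)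
    finally have "of_nat (Suc j) * fps_nth (?Y ^ Suc l) (Suc j)
        = fact (Suc l) * of_nat (Stirling (Suc j) (Suc l)) / fact j" .
    then have "fps_nth (?Y ^ Suc l) (Suc j)
        = (fact (Suc l) * of_nat (Stirling (Suc j) (Suc l)) / fact j) / of_nat (Suc j)"
      by (metis nonzero_mult_div_cancel_left of_nat_neq_0)
    then show ?thesis
      unfolding Suc fact_Suc[of j] by (simp only: divide_divide_eq_left of_nat_mult mult.commute)
  qed
qed

lemma map_poly_of_nat_mult:
  "map_poly of_nat (p * q) = (map_poly of_nat p * map_poly of_nat q :: 'a::comm_semiring_1 poly)"
  by (rule poly_eqI) (simp add: coeff_map_poly coeff_mult)

lemma map_poly_of_nat_power:
  "map_poly of_nat (p ^ k) = (map_poly of_nat p ^ k :: 'a::comm_semiring_1 poly)"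
  by (induction k) (simp_all add: map_poly_of_nat_mult)

text \<open>
  The defining identity of the generalized binomial coefficients, transferred from natural
  number polynomials to an arbitrary commutative semiring so that \<open>x\<close> may be an exponential
  series.
\<close>
lemma sum_gen_binomial_power:
  fixes x :: "'a::comm_semiring_1"
  shows "(\<Sum>q = 0..k * (n - 1). of_nat (gen_binomial k q n) * x ^ q) = (\<Sum>i<n. x ^ i) ^ k"
proof -
  let ?P = "\<Sum>i<n. monom 1 i :: nat poly"
  have "degree ?P \<le> n - 1"
    by (intro degree_sum_le) (auto intro: order.trans[OF degree_monom_le])
  then have deg: "degree (?P ^ k) \<le> k * (n - 1)"
    using degree_power_le[of ?P k] by (metis order.trans mult.commute mult_le_mono1)
  have "map_poly of_nat ?P = (\<Sum>i<n. monom 1 i :: 'a poly)"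
    by (rule poly_eqI) (simp add: coeff_map_poly coeff_sum)
  then have eval: "poly (map_poly of_nat (?P ^ k)) x = (\<Sum>i<n. x ^ i) ^ k"
    by (simp add: map_poly_of_nat_power poly_sum poly_monom)
  have "degree (map_poly of_nat (?P ^ k) :: 'a poly) \<le> k * (n - 1)"
    using deg by (intro degree_le) (simp add: coeff_map_poly coeff_eq_0)
  then have "poly (map_poly of_nat (?P ^ k)) x
      = (\<Sum>q\<le>k * (n - 1). coeff (map_poly of_nat (?P ^ k)) q * x ^ q)"
    unfolding poly_altdef by (intro sum.mono_neutral_left) (auto simp: coeff_eq_0)
  then show ?thesis
    by (simp only: eval coeff_map_poly of_nat_0 gen_binomial_def atMost_atLeast0)
qed

text \<open>
  The factor \<open>e\<^sup>t\<close> pulled out of each of the \<open>k\<close> geometric sums accounts for the shift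
  \<open>k + q\<close> in the bases of the power sum.
\<close>
lemma fps_nth_exp_sum_power:
  "fps_nth ((\<Sum>i<n. fps_exp (of_nat (Suc i) :: 'a::field_char_0)) ^ k) m
     = of_nat (power_sum m k n) / fact m"
proof -
  let ?e = "fps_exp (1::'a)"
  have "(\<Sum>i<n. fps_exp (of_nat (Suc i) :: 'a)) = ?e * (\<Sum>i<n. ?e ^ i)"
    by (simp add: sum_distrib_left fps_exp_power_mult fps_exp_add_mult)
  then have "(\<Sum>i<n. fps_exp (of_nat (Suc i) :: 'a)) ^ k
      = ?e ^ k * (\<Sum>q = 0..k * (n - 1). of_nat (gen_binomial k q n) * ?e ^ q)"
    by (simp only: power_mult_distrib sum_gen_binomial_power)
  also have "\<dots> = (\<Sum>q = 0..k * (n - 1).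
      fps_const (of_nat (gen_binomial k q n)) * fps_exp (of_nat (k + q)))"
    unfolding sum_distrib_left
    by (intro sum.cong refl)
      (simp add: fps_exp_power_mult fps_exp_add_mult fps_of_nat algebra_simps)
  finally show ?thesis
    by (simp add: fps_sum_nth power_sum_def sum_divide_distrib)
qed

lemma bernoulli_exp_sum_power:
  "Abs_fps (\<lambda>q. (-1) ^ q * bernoulli_higher k q / fact q) * (fps_exp (of_nat n) - 1) ^ k
     = fps_X ^ k * (\<Sum>i<n. fps_exp (of_nat (Suc i))) ^ k"
proof -
  let ?B = "Abs_fps (\<lambda>q. bernoulli_higher k q / fact q)"
  let ?B' = "Abs_fps (\<lambda>q. (-1) ^ q * bernoulli_higher k q / fact q)"
  let ?D = "1 - fps_exp (-1::rat)"
  let ?E = "\<Sum>i<n. fps_exp (of_nat (Suc i) :: rat)"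
  \<comment> \<open>the substitution of \<open>-t\<close> for \<open>t\<close> in the equation that characterizes \<open>?B\<close>\<close>
  have "(?B * (fps_exp 1 - 1) ^ k) oo (-fps_X) = fps_X ^ k oo (-fps_X)"
    by (simp only: bernoulli_higher_fps)
  moreover have "?B oo (-fps_X) = ?B'"
    by (simp add: fps_compose_uminus')
  moreover have "fps_exp (1::rat) oo (-fps_X) = fps_exp (-1)"
    by (simp add: fps_compose_uminus' fps_eq_iff)
  ultimately have "?B' * (fps_exp (-1) - 1) ^ k = (-fps_X) ^ k"
    by (simp add: fps_compose_mult_distrib fps_compose_power[symmetric] fps_compose_sub_distrib
        fps_X_power_compose)
  then have "(-1) ^ k * (?B' * (fps_exp (-1) - 1) ^ k) = (-1) ^ k * (-fps_X) ^ k"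
    by simp
  moreover have "(-1) ^ k * (fps_exp (-1::rat) - 1) ^ k = ?D ^ k"
    by (simp flip: power_mult_distrib)
  moreover have "(-1) ^ k * (-fps_X) ^ k = (fps_X ^ k :: rat fps)"
    by (simp flip: power_mult_distrib)
  ultimately have B: "?B' * ?D ^ k = fps_X ^ k"
    by (metis mult.left_commute)
  have telescope: "?D * ?E = fps_exp (of_nat n) - 1"
  proof (induction n)
    case (Suc n)
    have "fps_exp (-1) * fps_exp (of_nat (Suc n)) = fps_exp (of_nat n :: rat)"
      by (simp flip: fps_exp_add_mult)
    with Suc.IH show ?case
      by (simp only: sum.lessThan_Suc distrib_left left_diff_distrib) simp
  qed simp
  show ?thesis
    unfolding B[symmetric] telescope[symmetric] by (simp only: power_mult_distrib mult.assoc)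
qed

text \<open>
  The identity before division by \<open>m!\<close> and by the binomial coefficient: the coefficient of
  \<open>t ^ (m + k)\<close> in \<open>bernoulli_exp_sum_power\<close>.
\<close>
lemma power_sum_convolution:
  "of_nat (power_sum m k n) / fact m
     = (\<Sum>q = 0..m. (-1) ^ q * bernoulli_higher k q / fact q *
          (of_nat n ^ (m + k - q) * (fact k * of_nat (Stirling (m + k - q) k) / fact (m + k - q))))"
    (is "_ = (\<Sum>q = 0..m. ?f q)")
proof -
  have scale: "fps_exp (of_nat n :: rat) - 1 = (fps_exp 1 - 1) oo (fps_const (of_nat n) * fps_X)"
    by (simp add: fps_compose_sub_distrib)
  have stirling: "fps_nth ((fps_exp (of_nat n :: rat) - 1) ^ k) j
      = of_nat n ^ j * (fact k * of_nat (Stirling j k) / fact j)" for j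
  proof -
    have "(fps_exp (of_nat n :: rat) - 1) ^ k
        = (fps_exp 1 - 1) ^ k oo (fps_const (of_nat n) * fps_X)"
      unfolding scale by (rule fps_compose_power) simp
    then show ?thesis
      by (simp add: fps_compose_linear fps_nth_exp_minus_one_power)
  qed
  have "of_nat (power_sum m k n) / fact m
      = fps_nth (fps_X ^ k * (\<Sum>i<n. fps_exp (of_nat (Suc i) :: rat)) ^ k) (m + k)"
    by (simp only: fps_X_power_mult_nth fps_nth_exp_sum_power) simp
  also have "\<dots> = (\<Sum>q = 0..m + k. ?f q)"
    by (simp only: bernoulli_exp_sum_power[symmetric] fps_mult_nth stirling fps_nth_Abs_fps)
  also have "\<dots> = (\<Sum>q = 0..m. ?f q)"
    by (rule sum.mono_neutral_right) auto
  finally show ?thesis .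
qed

lemma power_sum_eq:
  "(of_nat (power_sum m k n) :: rat) =
     1 / of_nat ((m + k) choose k) *
     (\<Sum>q = 0..m. (-1) ^ q * of_nat ((m + k) choose q) * bernoulli_higher k q *
        of_nat (Stirling (m + k - q) k) * of_nat n ^ (m + k - q))"
proof -
  have "of_nat (power_sum m k n) = fact m * (of_nat (power_sum m k n) / fact m :: rat)"
    by simp
  also have "\<dots> = (\<Sum>q = 0..m. 1 / of_nat ((m + k) choose k) *
     ((-1) ^ q * of_nat ((m + k) choose q) * bernoulli_higher k q *
        of_nat (Stirling (m + k - q) k) * of_nat n ^ (m + k - q)))"
    unfolding power_sum_convolution sum_distrib_left
    by (intro sum.cong refl) (simp add: binomial_fact)
  finally show ?thesis
    by (simp only: sum_distrib_left)
qed

theorem theorem2p4: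
  fixes m k n :: nat
  assumes "k \<ge> 1" and "n \<ge> 1"
  shows "of_nat (power_sum m k n) = poly (power_sum_poly m k) (of_nat n)
       \<and> of_nat (\<Sum>q = 0..k * (n - 1). gen_binomial k q n * (k + q) ^ m) =
           1 / of_nat ((m + k) choose k) *
           (\<Sum>q = 0..m. (-1) ^ q * of_nat ((m + k) choose q) * bernoulli_higher k q *
              of_nat (Stirling (m + k - q) k) * of_nat n ^ (m + k - q))"
proof
  show "of_nat (power_sum m k n) = poly (power_sum_poly m k) (of_nat n)"
    unfolding power_sum_eq power_sum_poly_def by (simp add: poly_sum poly_monom)
qed (rule power_sum_eq[unfolded power_sum_def])

end
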